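(* Let $\mathbf{w}=[\mathrm{vec}(\mathbf{W}^{(1)})^T,\ldots,\mathrm{vec}(\mathbf{W}^{(L)})^T]^T\in\mathbb{R}^{R\sum_{\ell=1}^L I_\ell}$, with $\mathbf{W}^{(\ell)}\in\mathbb{R}^{I_\ell\times R}$, and let $f$ be the residual map of the rank-$R$ CPD problem for a tensor $\mathcal{T}\in\mathbb{R}^{I_1\times\cdots\times I_L}$, with all derivatives of $f$ evaluated at $\mathbf{w}$. Given any vector $\mathbf{v}\in\mathbb{R}^{R\sum_{\ell=1}^L I_\ell}$, write $\mathbf{v}=[\mathrm{vec}(\mathbf{V}^{(1)})^T,\ldots,\mathrm{vec}(\mathbf{V}^{(L)})^T]^T$ with $\mathbf{V}^{(\ell)}=[\mathbf{v}^{(\ell)}_1,\ldots,\mathbf{v}^{(\ell)}_R]\in\mathbb{R}^{I_\ell\times R}$. Then $$\mathbf{J}_f^T\mathbf{J}_f\cdot\mathbf{v}=\begin{bmatrix}\displaystyle\sum_{\ell=1}^L \left(\frac{\partial f}{\partial \mathbf{W}^{(1)}}\right)^T\frac{\partial f}{\partial \mathbf{W}^{(\ell)}}\cdot \mathrm{vec}(\mathbf{V}^{(\ell)})\\ \vdots\\ \displaystyle\sum_{\ell=1}^L \left(\frac{\partial f}{\partial \mathbf{W}^{(L)}}\right)^T\frac{\partial f}{\partial \mathbf{W}^{(\ell)}}\cdot \mathrm{vec}(\mathbf{V}^{(\ell)})\end{bmatrix},$$ where, for $\ell'\neq\ell''$, $$\left(\frac{\partial f}{\partial \mathbf{W}^{(\ell')}}\right)^T\frac{\partial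 f}{\partial \mathbf{W}^{(\ell'')}}\cdot \mathrm{vec}(\mathbf{V}^{(\ell'')})=\mathrm{vec}\Big(\mathbf{W}^{(\ell')}\cdot\big(\Pi^{(\ell',\ell'')}\ast(\mathbf{V}^{(\ell'')T}\cdot\mathbf{W}^{(\ell'')})\big)\Big),$$ and, for every $\ell'$, $$\left(\frac{\partial f}{\partial \mathbf{W}^{(\ell')}}\right)^T\frac{\partial f}{\partial \mathbf{W}^{(\ell')}}\cdot \mathrm{vec}(\mathbf{V}^{(\ell')})=\mathrm{vec}\big(\mathbf{V}^{(\ell')}\cdot\Pi^{(\ell')}\big).$$
   Context: Fix positive integers $L$, $R$, $I_1,\ldots,I_L$ and a real tensor $\mathcal{T}=(t_{i_1\ldots i_L})\in\mathbb{R}^{I_1\times\cdots\times I_L}$. For a matrix $\mathbf{X}$, $\mathrm{vec}(\mathbf{X})$ is the column vector obtained by vertically stacking the columns of $\mathbf{X}$. The columns of $\mathbf{W}^{(\ell)}\in\mathbb{R}^{I_\ell\times R}$ are $\mathbf{w}^{(\ell)}_1,\ldots,\mathbf{w}^{(\ell)}_R$, and $w^{(\ell)}_{ir}$ is the $(i,r)$ entry of $\mathbf{W}^{(\ell)}$. The residual map $f:\mathbb{R}^{R\sum_\ell I_\ell}\to\mathbb{R}^{\prod_\ell I_\ell}$ has components, indexed by multi-indices $(i_1,\ldots,i_L)$ in lexicographic order, $$f_{i_1\ldots i_L}(\mathbf{w})=t_{i_1\ldots i_L}-\sum_{r=1}^R w^{(1)}_{i_1r}\cdots w^{(L)}_{i_Lr}.$$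 $\frac{\partial f}{\partial\mathbf{W}^{(\ell)}}\in\mathbb{R}^{(\prod_j I_j)\times I_\ell R}$ is the Jacobian of $f$ with respect to the variables $\mathrm{vec}(\mathbf{W}^{(\ell)})$, and $\mathbf{J}_f=\big[\frac{\partial f}{\partial\mathbf{W}^{(1)}},\ldots,\frac{\partial f}{\partial\mathbf{W}^{(L)}}\big]$ is the Jacobian matrix of $f$. The symbol $\ast$ is the entrywise (Hadamard) product. Put $\omega^{(\ell)}_{r'r''}=\langle\mathbf{w}^{(\ell)}_{r'},\mathbf{w}^{(\ell)}_{r''}\rangle$ (Euclidean inner product). For $\ell'\neq\ell''$, $\Pi^{(\ell',\ell'')}\in\mathbb{R}^{R\times R}$ is the matrix with $(r',r'')$ entry $\prod_{\ell\neq\ell',\ell''}\omega^{(\ell)}_{r'r''}$, and $\Pi^{(\ell')}\in\mathbb{R}^{R\times R}$ is the matrix with $(r',r'')$ entry $\prod_{\ell\neq\ell'}\omega^{(\ell)}_{r'r''}$ (empty products equal 1). *)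

theory Defs
  imports "HOL-Analysis.Derivative" "Jordan_Normal_Form.Matrix"
begin

(* Matrix and vector syntax below is that of Jordan_Normal_Form, not of HOL-Analysis. *)
unbundle no inner_syntax and no vec_syntax

definition stack :: "'a vec list \<Rightarrow> 'a vec" where
  "stack xs = foldr (@\<^sub>v) xs vNil"

definition vectorize :: "'a mat \<Rightarrow> 'a vec" where
  "vectorize X = stack (cols X)"

definition hadamard :: "'a::times mat \<Rightarrow> 'a mat \<Rightarrow> 'a mat" where
  "hadamard A B = mat (dim_row A) (dim_col A) (\<lambda>ij. A $$ ij * B $$ ij)"

definition jacobian :: "(real vec \<Rightarrow> real vec) \<Rightarrow> real vec \<Rightarrow> real mat" where
  "jacobian F x = mat (dim_vec (F x)) (dim_vec x)
     (\<lambda>(i, j). deriv (\<lambda>s. F (x + s \<cdot>\<^sub>v unit_vec (dim_vec x) j) $ i) 0)"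

(* Jacobian of F with respect to the l-th block of the stacked argument, the other blocks fixed. *)
definition block_jacobian :: "(real vec \<Rightarrow> real vec) \<Rightarrow> real vec list \<Rightarrow> nat \<Rightarrow> real mat" where
  "block_jacobian F xs l = jacobian (\<lambda>z. F (stack (xs[l := z]))) (xs ! l)"

(* Tensor dimensions are a list Is of length L; all indices start from 0.
   product_lists enumerates the multi-indices in lexicographic order, the last index
   varying fastest. *)
definition multi_indices :: "nat list \<Rightarrow> nat list list" where
  "multi_indices Is = product_lists (map (\<lambda>n. [0..<n]) Is)"

(* The l-th factor matrix contained in a stacked vector; see stack_factor and factor_stack. *)
definition factor :: "nat list \<Rightarrow> nat \<Rightarrow> real vec \<Rightarrow> nat \<Rightarrow> real mat" where
  "factor Is R w l = mat (Is ! l) R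
     (\<lambda>(i, r). w $ (R * sum_list (take l Is) + (r * Is ! l + i)))"

definition residual :: "nat list \<Rightarrow> nat \<Rightarrow> (nat list \<Rightarrow> real) \<Rightarrow> real vec \<Rightarrow> real vec" where
  "residual Is R T w = vec_of_list (map
     (\<lambda>idx. T idx - (\<Sum>r<R. \<Prod>l<length Is. factor Is R w l $$ (idx ! l, r)))
     (multi_indices Is))"

definition omega :: "real mat list \<Rightarrow> nat \<Rightarrow> nat \<Rightarrow> nat \<Rightarrow> real" where
  "omega Ws l r' r'' = col (Ws ! l) r' \<bullet> col (Ws ! l) r''"

(* Omitting {l'} gives the one-index matrix Pi, omitting {l', l''} the two-index one. *)
definition Pi_omit :: "real mat list \<Rightarrow> nat \<Rightarrow> nat set \<Rightarrow> real mat" where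
  "Pi_omit Ws R S = mat R R (\<lambda>(r', r''). \<Prod>l\<in>{..<length Ws} - S. omega Ws l r' r'')"

definition factor_list :: "nat list \<Rightarrow> nat \<Rightarrow> real mat list \<Rightarrow> bool" where
  "factor_list Is R Ws \<longleftrightarrow>
     length Ws = length Is \<and> (\<forall>l<length Is. Ws ! l \<in> carrier_mat (Is ! l) R)"

lemma stack_Nil [simp]: "stack [] = vNil"
  and stack_Cons [simp]: "stack (x # xs) = x @\<^sub>v stack xs"
  by (simp_all add: stack_def)

lemma dim_stack: "dim_vec (stack xs) = (\<Sum>x\<leftarrow>xs. dim_vec x)"
  by (induction xs) auto

lemma stack_index:
  assumes "l < length xs" "j < dim_vec (xs ! l)"
  shows "stack xs $ ((\<Sum>x\<leftarrow>take l xs. dim_vec x) + j) = xs ! l $ j"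
  using assms
proof (induction xs arbitrary: l)
  case (Cons x xs)
  show ?case
  proof (cases l)
    case 0
    then show ?thesis using Cons.prems by simp
  next
    case (Suc m)
    have IH: "stack xs $ ((\<Sum>x\<leftarrow>take m xs. dim_vec x) + j) = xs ! m $ j"
      using Cons Suc by simp
    have "xs = take m xs @ xs ! m # drop (Suc m) xs"
      using Cons.prems Suc by (simp add: id_take_nth_drop)
    then have "(\<Sum>x\<leftarrow>xs. dim_vec x) =
        (\<Sum>x\<leftarrow>take m xs @ xs ! m # drop (Suc m) xs. dim_vec x)"
      by simp
    then have "(\<Sum>x\<leftarrow>take m xs. dim_vec x) + j < dim_vec (stack xs)"
      using Cons.prems Suc by (simp add: dim_stack)
    then show ?thesis using Suc IH by (simp add: add.assoc)
  qed
qed simp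

lemma stack_index_cases:
  assumes "k < dim_vec (stack xs)"
  obtains l j where "l < length xs" "j < dim_vec (xs ! l)"
    "k = (\<Sum>x\<leftarrow>take l xs. dim_vec x) + j"
  using assms
proof (induction xs arbitrary: k thesis)
  case (Cons x xs)
  show ?case
  proof (cases "k < dim_vec x")
    case True
    then show ?thesis using Cons.prems(1)[of 0 k] by simp
  next
    case False
    then have "k - dim_vec x < dim_vec (stack xs)" using Cons.prems(2) by simp
    then obtain l j where "l < length xs" "j < dim_vec (xs ! l)"
      "k - dim_vec x = (\<Sum>x\<leftarrow>take l xs. dim_vec x) + j"
      using Cons.IH by blast
    then show ?thesis using Cons.prems(1)[of "Suc l" j] False by simp
  qed
qed simp

lemma sum_list_take_cols: "l \<le> dim_col X \<Longrightarrow> (\<Sum>x\<leftarrow>take l (cols X). dim_vec x) = l * dim_row X"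
proof -
  assume "l \<le> dim_col X"
  moreover have "\<forall>x\<in>set (take l (cols X)). dim_vec x = dim_row X"
    using in_set_takeD cols_dim by fastforce
  then have "map dim_vec (take l (cols X)) = map (\<lambda>_. dim_row X) (take l (cols X))"
    by simp
  ultimately show "(\<Sum>x\<leftarrow>take l (cols X). dim_vec x) = l * dim_row X"
    by (simp only: sum_list_triv) simp
qed

lemma dim_vectorize: "dim_vec (vectorize X) = dim_col X * dim_row X"
  using sum_list_take_cols[of "dim_col X" X] by (simp add: vectorize_def dim_stack)

lemma vectorize_index:
  assumes "i < dim_row X" "r < dim_col X"
  shows "vectorize X $ (r * dim_row X + i) = X $$ (i, r)"
  using stack_index[of r "cols X" i] assms
  by (simp add: vectorize_def sum_list_take_cols)

lemma dims_vectorize: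
  assumes "factor_list Is R Ws"
  shows "map (\<lambda>X. dim_vec (vectorize X)) Ws = map (\<lambda>n. R * n) Is"
  using assms by (intro nth_equalityI) (auto simp: factor_list_def dim_vectorize)

lemma dim_stack_factors:
  assumes "factor_list Is R Ws"
  shows "dim_vec (stack (map vectorize Ws)) = R * sum_list Is"
  using dims_vectorize[OF assms] by (simp add: dim_stack o_def sum_list_const_mult)

lemma offset_factors:
  assumes "factor_list Is R Ws"
  shows "(\<Sum>x\<leftarrow>take l (map vectorize Ws). dim_vec x) = R * sum_list (take l Is)"
proof -
  have "map dim_vec (take l (map vectorize Ws)) = take l (map (\<lambda>n. R * n) Is)"
    using dims_vectorize[OF assms] by (simp add: take_map o_def flip: take_map)
  then show ?thesis
    using sum_list_const_mult[of R id "take l Is"] by (simp add: take_map)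
qed

lemma factor_stack:
  assumes "factor_list Is R Ws" "l < length Is"
  shows "factor Is R (stack (map vectorize Ws)) l = Ws ! l"
proof -
  have X: "Ws ! l \<in> carrier_mat (Is ! l) R" and l: "l < length Ws"
    using assms by (auto simp: factor_list_def)
  show ?thesis
  proof (rule eq_matI)
    fix i r assume ir: "i < dim_row (Ws ! l)" "r < dim_col (Ws ! l)"
    have "r * dim_row (Ws ! l) + i < Suc r * dim_row (Ws ! l)" using ir by simp
    also have "\<dots> \<le> dim_col (Ws ! l) * dim_row (Ws ! l)"
      using ir by (intro mult_right_mono) auto
    finally have "r * dim_row (Ws ! l) + i < dim_vec (vectorize (Ws ! l))"
      by (simp add: dim_vectorize)
    then show "factor Is R (stack (map vectorize Ws)) l $$ (i, r) = Ws ! l $$ (i, r)"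
      using stack_index[of l "map vectorize Ws" "r * dim_row (Ws ! l) + i"] l X ir
        vectorize_index[OF ir]
      unfolding offset_factors[OF assms(1)]
      by (simp add: factor_def)
  qed (use X in \<open>auto simp: factor_def\<close>)
qed

lemma factor_list_factors: "factor_list Is R (map (factor Is R w) [0..<length Is])"
  by (auto simp: factor_list_def factor_def)

lemma stack_factor:
  assumes "w \<in> carrier_vec (R * sum_list Is)"
  shows "stack (map vectorize (map (factor Is R w) [0..<length Is])) = w"
proof -
  let ?Ws = "map (factor Is R w) [0..<length Is]"
  note F = factor_list_factors[of Is R w]
  show ?thesis
  proof (rule eq_vecI)
    fix k assume "k < dim_vec w"
    then have "k < dim_vec (stack (map vectorize ?Ws))"
      using assms dim_stack_factors[OF F] by simp
    then obtain l j where l: "l < length Is" and j: "j < dim_vec (map vectorize ?Ws ! l)"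
      and k: "k = (\<Sum>x\<leftarrow>take l (map vectorize ?Ws). dim_vec x) + j"
      by (elim stack_index_cases) auto
    have d: "dim_row (factor Is R w l) = Is ! l" "dim_col (factor Is R w l) = R"
      by (auto simp: factor_def)
    have j': "j < R * Is ! l" using j l d by (simp add: dim_vectorize)
    then have pos: "0 < Is ! l" by (cases "Is ! l") auto
    have m: "j mod Is ! l < Is ! l" "j div Is ! l < R"
      using pos j' by (auto simp: less_mult_imp_div_less)
    have "stack (map vectorize ?Ws) $ k = vectorize (factor Is R w l) $ j"
      using stack_index[of l "map vectorize ?Ws" j] l j k by simp
    also have "\<dots> = factor Is R w l $$ (j mod Is ! l, j div Is ! l)"
      using vectorize_index[of "j mod Is ! l" "factor Is R w l" "j div Is ! l"] m d
      by (simp only: div_mult_mod_eq)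
    also have "\<dots> = w $ (R * sum_list (take l Is) + j)"
      using m by (simp add: factor_def) (simp only: div_mult_mod_eq)
    finally show "stack (map vectorize ?Ws) $ k = w $ k"
      using k offset_factors[OF F] by simp
  qed (use assms dim_stack_factors[OF F] in simp)
qed

end

(* The residual is affine in each factor matrix, so the derivative with respect to the (i, r)
   entry of the l-th factor is minus the rank-one tensor of the r-th columns with the l-th one
   replaced by the i-th unit vector, and a block of J v is minus the CPD sum with the l-th factor
   replaced by V.  Inner products of rank-one tensors factor into products of inner products of
   their columns (a sum over multi-indices of products is a product of sums), which gives both
   block formulas; the block form of J^T J v is the splitting of a sum over a stacked index. *)

theory Submission
  imports Defs
begin

section \<open>Coordinates of stacked and vectorized arguments\<close>

text \<open>A coordinate direction of the stacked space lies inside a single block. This lets a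
  partial derivative in the full argument be read as one in that block alone.\<close>

lemma stack_add_unit_vec:
  fixes xs :: "'a::semiring_1 vec list"
  assumes "l < length xs" "j < dim_vec (xs ! l)"
  shows "stack xs + s \<cdot>\<^sub>v unit_vec (dim_vec (stack xs)) ((\<Sum>x\<leftarrow>take l xs. dim_vec x) + j)
    = stack (xs[l := xs ! l + s \<cdot>\<^sub>v unit_vec (dim_vec (xs ! l)) j])"
  using assms
proof (induction xs arbitrary: l)
  case (Cons x xs)
  show ?case
  proof (cases l)
    case 0
    with Cons.prems show ?thesis by (intro eq_vecI) auto
  next
    case (Suc m)
    let ?o = "(\<Sum>x\<leftarrow>take m xs. dim_vec x) + j"
    have "stack (xs[m := xs ! m + s \<cdot>\<^sub>v unit_vec (dim_vec (xs ! m)) j])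
        = stack xs + s \<cdot>\<^sub>v unit_vec (dim_vec (stack xs)) ?o"
      using Cons Suc by simp
    with Suc show ?thesis by (intro eq_vecI) (auto simp: unit_vec_def add.assoc)
  qed
qed simp

text \<open>Peel off the first block. The induction generalizes \<open>g\<close> because the indices
  of the tail are shifted by \<open>dim_vec x\<close>.\<close>

lemma sum_stack_index:
  fixes g :: "nat \<Rightarrow> 'b::comm_monoid_add"
  shows "(\<Sum>k<dim_vec (stack xs). g k)
    = (\<Sum>l<length xs. \<Sum>j<dim_vec (xs ! l). g ((\<Sum>x\<leftarrow>take l xs. dim_vec x) + j))"
proof (induction xs arbitrary: g)
  case (Cons x xs)
  have "(\<Sum>k<dim_vec (stack (x # xs)). g k)
      = (\<Sum>k<dim_vec x. g k) + (\<Sum>k<dim_vec (stack xs). g (dim_vec x + k))"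
  proof -
    have "(\<Sum>k<a + b. g k) = (\<Sum>k<a. g k) + (\<Sum>k<b. g (a + k))" for a b
      by (induction b) (simp_all add: add.assoc)
    then show ?thesis by simp
  qed
  then show ?case
    unfolding Cons.IH by (simp add: sum.lessThan_Suc_shift add.assoc del: sum.lessThan_Suc)
qed simp

text \<open>In a vectorized matrix with \<open>n\<close> rows, position \<open>r * n + i\<close>
  holds entry \<open>(i, r)\<close>, so this turns a sum over positions into one over columns and
  rows.\<close>

lemma sum_less_mult:
  fixes g :: "nat \<Rightarrow> 'b::comm_monoid_add"
  shows "(\<Sum>k<R * n. g k) = (\<Sum>r<R. \<Sum>i<n. g (r * n + i))"
proof -
  have "(\<Sum>k<R * n. g k) = (\<Sum>r<R. sum g {r * n..<r * n + n})"
    by (simp add: sum.nat_group)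
  also have "\<dots> = (\<Sum>r<R. \<Sum>i<n. g (r * n + i))"
    by (simp add: sum.atLeastLessThan_shift_0 [of g] lessThan_atLeast0)
  finally show ?thesis .
qed

lemma mult_add_less:
  fixes n :: nat
  assumes "i < n" "r < R"
  shows "r * n + i < R * n"
proof -
  have "r * n + i < Suc r * n" using assms by simp
  also have "\<dots> \<le> R * n" using assms by (intro mult_right_mono) auto
  finally show ?thesis .
qed

text \<open>Division by \<open>n\<close> recovers the column \<open>r\<close>, so distinct matrix
  entries occupy distinct positions of the vectorization.\<close>

lemma mult_add_eq_iff:
  fixes n :: nat
  assumes "i < n" "i' < n"
  shows "r * n + i = r' * n + i' \<longleftrightarrow> r = r' \<and> i = i'"
proof
  assume eq: "r * n + i = r' * n + i'"
  have "(r * n + i) div n = r" "(r' * n + i') div n = r'" using assms by auto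
  with eq show "r = r' \<and> i = i'" by simp
qed simp

section \<open>Sums over multi-indices\<close>

lemma nth_in_multi_indices_less:
  "idx \<in> set (multi_indices Is) \<Longrightarrow> k < length Is \<Longrightarrow> idx ! k < Is ! k"
  by (auto simp: multi_indices_def product_lists_set list_all2_conv_all_nth)

text \<open>Distributivity, one index at a time: the factor of the first index leaves the inner sum,
  and the induction hypothesis applies to \<open>g\<close> shifted by one place.\<close>

lemma sum_list_multi_indices_prod:
  fixes g :: "nat \<Rightarrow> nat \<Rightarrow> 'a::comm_semiring_1"
  shows "(\<Sum>idx\<leftarrow>multi_indices Is. \<Prod>k<length Is. g k (idx ! k))
    = (\<Prod>k<length Is. \<Sum>x<Is ! k. g k x)"
proof (induction Is arbitrary: g)
  case (Cons n Is)
  have "(\<Sum>idx\<leftarrow>multi_indices (n # Is). \<Prod>k<length (n # Is). g k (idx ! k))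
      = (\<Sum>x\<leftarrow>[0..<n]. g 0 x * (\<Sum>idx\<leftarrow>multi_indices Is. \<Prod>k<length Is. g (Suc k) (idx ! k)))"
  proof -
    \<comment> \<open>\<open>product_lists\<close> concatenates one list of multi-indices for each
      first index, so the sum over it is nested.\<close>
    have "(\<Sum>y\<leftarrow>concat (map h xs). F y) = (\<Sum>x\<leftarrow>xs. \<Sum>y\<leftarrow>h x. F y)"
      for h :: "nat \<Rightarrow> nat list list" and F :: "nat list \<Rightarrow> 'a" and xs
      by (induction xs) auto
    then show ?thesis
      by (simp add: multi_indices_def o_def sum_list_const_mult
          prod.lessThan_Suc_shift del: prod.lessThan_Suc upt_Suc)
  qed
  also have "\<dots> = (\<Sum>x<n. g 0 x) * (\<Prod>k<length Is. \<Sum>x<Is ! k. g (Suc k) x)"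
    unfolding Cons.IH[of "\<lambda>k. g (Suc k)"]
    by (simp add: interv_sum_list_conv_sum_set_nat sum_distrib_right lessThan_atLeast0)
  finally show ?case
    by (simp add: prod.lessThan_Suc_shift del: prod.lessThan_Suc)
qed (simp add: multi_indices_def)

lemma sum_multi_indices_nth:
  "(\<Sum>p<length (multi_indices Is). g (multi_indices Is ! p)) = (\<Sum>idx\<leftarrow>multi_indices Is. g idx)"
  by (simp add: sum_list_sum_nth lessThan_atLeast0)

section \<open>Entries of matrix products\<close>

text \<open>By associativity the entry is the inner product of column \<open>j\<close> of
  \<open>A\<close> with \<open>B *\<^sub>v v\<close>, so the Gramian itself is never
  expanded.\<close>

lemma transpose_mult_mult_vec_index:
  fixes A B :: "'a::comm_semiring_0 mat"
  assumes "A \<in> carrier_mat N a" "B \<in> carrier_mat N b" "v \<in> carrier_vec b" "j < a"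
  shows "((transpose_mat A * B) *\<^sub>v v) $ j
    = (\<Sum>p<N. A $$ (p, j) * (\<Sum>k<b. B $$ (p, k) * v $ k))"
proof -
  have "(transpose_mat A * B) *\<^sub>v v = transpose_mat A *\<^sub>v (B *\<^sub>v v)"
    using assms by (intro assoc_mult_mat_vec[of _ a N _ b]) auto
  then show ?thesis
    using assms by (simp add: scalar_prod_def lessThan_atLeast0)
qed

lemma mult_index_sum:
  assumes "i < dim_row A" "j < dim_col B" "dim_col A = dim_row B"
  shows "(A * B) $$ (i, j) = (\<Sum>k<dim_row B. A $$ (i, k) * B $$ (k, j))"
  using assms by (simp add: scalar_prod_def lessThan_atLeast0)

section \<open>The residual as a function of one factor\<close>

lemma dim_residual: "dim_vec (residual Is R T w) = length (multi_indices Is)"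
  by (simp add: residual_def)

text \<open>The blocks are arbitrary vectors, constrained only in size, so that a block perturbed as
  a vector is covered too.\<close>

lemma factor_stack_index:
  assumes "l < length xs" "dim_vec (xs ! l) = R * Is ! l"
    and "(\<Sum>x\<leftarrow>take l xs. dim_vec x) = R * sum_list (take l Is)"
    and "i < Is ! l" "r < R"
  shows "factor Is R (stack xs) l $$ (i, r) = xs ! l $ (r * Is ! l + i)"
  using stack_index[of l xs "r * Is ! l + i"] mult_add_less[of i "Is ! l" r R] assms
  by (simp add: factor_def)

text \<open>Each rank-one term contains exactly one entry of the \<open>l\<close>-th factor. Pulling
  it out of the product shows that the residual is affine in \<open>z\<close>.\<close>

lemma residual_stack_update_index:
  assumes F: "factor_list Is R Ws" and l: "l < length Is"
    and z: "dim_vec z = R * Is ! l" and p: "p < length (multi_indices Is)"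
  defines "idx \<equiv> multi_indices Is ! p"
  shows "residual Is R T (stack ((map vectorize Ws)[l := z])) $ p = T idx -
    (\<Sum>r<R. z $ (r * Is ! l + idx ! l) * (\<Prod>k\<in>{..<length Is} - {l}. Ws ! k $$ (idx ! k, r)))"
proof -
  let ?xs = "(map vectorize Ws)[l := z]"
  have len: "length Ws = length Is" using F by (simp add: factor_list_def)
  have W: "Ws ! k \<in> carrier_mat (Is ! k) R" if "k < length Is" for k
    using F that by (simp add: factor_list_def)
  have idx: "idx ! k < Is ! k" if "k < length Is" for k
    using p that unfolding idx_def by (intro nth_in_multi_indices_less) auto
  have dl: "dim_vec (map vectorize Ws ! l) = dim_vec z"
    using W[OF l] z l len by (auto simp: dim_vectorize)
  \<comment> \<open>The new block has the size of the old one, so no block offset moves.\<close>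
  have "map dim_vec ?xs = map dim_vec (map vectorize Ws)"
    using l len dl by (metis list_update_id map_update)
  then have off: "(\<Sum>x\<leftarrow>take k ?xs. dim_vec x) = R * sum_list (take k Is)" for k
    using offset_factors[OF F, of k] by (metis take_map)
  have fac: "factor Is R (stack ?xs) k $$ (idx ! k, r)
      = (if k = l then z $ (r * Is ! l + idx ! l) else Ws ! k $$ (idx ! k, r))"
    if k: "k < length Is" and r: "r < R" for k r
  proof -
    have "dim_vec (?xs ! k) = R * Is ! k"
      using W[OF k] k len z by (cases "k = l") (auto simp: dim_vectorize)
    then have "factor Is R (stack ?xs) k $$ (idx ! k, r) = ?xs ! k $ (r * Is ! k + idx ! k)"
      using k r len idx[OF k] off by (intro factor_stack_index) simp_all
    then show ?thesis
      using vectorize_index[of "idx ! k" "Ws ! k" r] W[OF k] k r len idx[OF k] by auto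
  qed
  have "(\<Prod>k<length Is. factor Is R (stack ?xs) k $$ (idx ! k, r))
      = z $ (r * Is ! l + idx ! l) * (\<Prod>k\<in>{..<length Is} - {l}. Ws ! k $$ (idx ! k, r))"
    if r: "r < R" for r
    using l r by (simp add: fac prod.remove[of _ l])
  then show ?thesis
    using p by (simp add: residual_def idx_def vec_of_list_index)
qed

section \<open>Jacobian blocks of the residual and their Gramians\<close>

text \<open>Entry \<open>(i, r)\<close> of the \<open>l\<close>-th factor occurs only in the
  \<open>r\<close>-th rank-one term, and there only if the \<open>l\<close>-th index is
  \<open>i\<close>; its coefficient is the product of the other factors.\<close>

lemma block_jacobian_residual_index:
  assumes F: "factor_list Is R Ws" and l: "l < length Is" and p: "p < length (multi_indices Is)"
    and i: "i < Is ! l" and r: "r < R"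
  defines "idx \<equiv> multi_indices Is ! p"
  shows "block_jacobian (residual Is R T) (map vectorize Ws) l $$ (p, r * Is ! l + i)
    = - ((if idx ! l = i then 1 else 0) * (\<Prod>k\<in>{..<length Is} - {l}. Ws ! k $$ (idx ! k, r)))"
proof -
  let ?x = "map vectorize Ws ! l" and ?j = "r * Is ! l + i"
  let ?P = "\<lambda>r'. \<Prod>k\<in>{..<length Is} - {l}. Ws ! k $$ (idx ! k, r')"
  let ?c = "T idx - (\<Sum>r'<R. ?x $ (r' * Is ! l + idx ! l) * ?P r')"
  have dx: "dim_vec ?x = R * Is ! l"
    using F l by (auto simp: factor_list_def dim_vectorize)
  have j: "?j < dim_vec ?x" using dx mult_add_less[OF i r] by simp
  have il: "idx ! l < Is ! l"
    using p l unfolding idx_def by (intro nth_in_multi_indices_less) auto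
  \<comment> \<open>Along a coordinate line the component is exactly affine in \<open>s\<close>, so
    the derivative is its slope.\<close>
  have affine: "residual Is R T (stack ((map vectorize Ws)[l := ?x + s \<cdot>\<^sub>v unit_vec (dim_vec ?x) ?j])) $ p
      = ?c + s * - ((if idx ! l = i then 1 else 0) * ?P r)" for s
  proof -
    have "(\<Sum>r'<R. (?x + s \<cdot>\<^sub>v unit_vec (dim_vec ?x) ?j) $ (r' * Is ! l + idx ! l) * ?P r')
        = (\<Sum>r'<R. ?x $ (r' * Is ! l + idx ! l) * ?P r'
            + (if r' = r then s * ((if idx ! l = i then 1 else 0) * ?P r) else 0))"
    proof (intro sum.cong refl)
      fix r' assume "r' \<in> {..<R}"
      then have "r' * Is ! l + idx ! l < dim_vec ?x" using dx il mult_add_less by simp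
      then show "(?x + s \<cdot>\<^sub>v unit_vec (dim_vec ?x) ?j) $ (r' * Is ! l + idx ! l) * ?P r'
          = ?x $ (r' * Is ! l + idx ! l) * ?P r'
            + (if r' = r then s * ((if idx ! l = i then 1 else 0) * ?P r) else 0)"
        using j mult_add_eq_iff[OF il i, of r' r] by (auto simp: distrib_right)
    qed
    then show ?thesis
      using residual_stack_update_index[OF F l _ p, of "?x + s \<cdot>\<^sub>v unit_vec (dim_vec ?x) ?j" T] dx r
      by (simp add: idx_def sum.distrib)
  qed
  have "((\<lambda>s. ?c + s * D) has_real_derivative D) (at 0)" for D
    by (auto intro!: derivative_eq_intros)
  then have "deriv (\<lambda>s. residual Is R T (stack ((map vectorize Ws)[l := ?x + s \<cdot>\<^sub>v unit_vec (dim_vec ?x) ?j])) $ p) 0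
      = - ((if idx ! l = i then 1 else 0) * ?P r)"
    unfolding affine by (rule DERIV_imp_deriv)
  then show ?thesis
    using p j by (simp add: block_jacobian_def jacobian_def dim_residual)
qed

lemma block_jacobian_residual_carrier:
  assumes "factor_list Is R Ws" "l < length Is"
  shows "block_jacobian (residual Is R T) (map vectorize Ws) l
    \<in> carrier_mat (length (multi_indices Is)) (R * Is ! l)"
  using assms by (auto simp: block_jacobian_def jacobian_def dim_residual factor_list_def dim_vectorize)

text \<open>The indicator in the Jacobian entry selects row \<open>idx ! l\<close> of
  \<open>V\<close>, which completes the product over the other factors with \<open>V\<close> in
  place \<open>l\<close>.\<close>

lemma block_jacobian_residual_mult_vectorize:
  assumes F: "factor_list Is R Ws" and l: "l < length Is" and p: "p < length (multi_indices Is)"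
    and V: "V \<in> carrier_mat (Is ! l) R"
  defines "idx \<equiv> multi_indices Is ! p"
  shows "(\<Sum>k<R * Is ! l. block_jacobian (residual Is R T) (map vectorize Ws) l $$ (p, k) * vectorize V $ k)
    = - (\<Sum>r<R. \<Prod>k<length Is. Ws[l := V] ! k $$ (idx ! k, r))"
proof -
  let ?P = "\<lambda>r. \<Prod>k\<in>{..<length Is} - {l}. Ws ! k $$ (idx ! k, r)"
  have len: "length Ws = length Is" using F by (simp add: factor_list_def)
  have il: "idx ! l < Is ! l"
    using p l unfolding idx_def by (intro nth_in_multi_indices_less) auto
  have "(\<Sum>i<Is ! l. block_jacobian (residual Is R T) (map vectorize Ws) l $$ (p, r * Is ! l + i)
        * vectorize V $ (r * Is ! l + i)) = - (\<Prod>k<length Is. Ws[l := V] ! k $$ (idx ! k, r))"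
    if r: "r < R" for r
  proof -
    have "(\<Sum>i<Is ! l. block_jacobian (residual Is R T) (map vectorize Ws) l $$ (p, r * Is ! l + i)
        * vectorize V $ (r * Is ! l + i)) = (\<Sum>i<Is ! l. if i = idx ! l then - (?P r * V $$ (idx ! l, r)) else 0)"
      using block_jacobian_residual_index[OF F l p _ r, of _ T] vectorize_index[of _ V r] V r
      by (intro sum.cong) (auto simp: idx_def)
    also have "\<dots> = - (V $$ (idx ! l, r) * ?P r)"
      using il by simp
    also have "\<dots> = - (\<Prod>k<length Is. Ws[l := V] ! k $$ (idx ! k, r))"
      using l len by (simp add: prod.remove[of _ l])
    finally show ?thesis .
  qed
  then show ?thesis
    by (simp add: sum_less_mult sum_negf)
qed

text \<open>Taking \<open>V\<close> as the \<open>l\<close>-th factor covers both block formulas: for \<open>l = l'\<close> the replaced factor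
  is the one outside the product, for \<open>l \<noteq> l'\<close> it contributes an entry of \<open>V\<^sup>T W\<close> inside it.\<close>
lemma block_gramian_index:
  fixes T :: "nat list \<Rightarrow> real"
  assumes F: "factor_list Is R Ws" and l': "l' < length Is" and l: "l < length Is"
    and V: "V \<in> carrier_mat (Is ! l) R" and i: "i < Is ! l'" and r: "r < R"
  defines "D \<equiv> block_jacobian (residual Is R T) (map vectorize Ws)"
  shows "((transpose_mat (D l') * D l) *\<^sub>v vectorize V) $ (r * Is ! l' + i)
    = (\<Sum>r'<R. Ws[l := V] ! l' $$ (i, r')
        * (\<Prod>k\<in>{..<length Is} - {l'}. col (Ws[l := V] ! k) r' \<bullet> col (Ws ! k) r))"
proof -
  let ?N = "length (multi_indices Is)" and ?B = "Ws[l := V]"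
  \<comment> \<open>\<open>?A k\<close> is the \<open>k\<close>-th vector of the rank-one tensor
    whose negative is the Jacobian column at \<open>(i, r)\<close>: the \<open>i\<close>-th unit
    vector at \<open>l'\<close>, the \<open>r\<close>-th column of the factor elsewhere.\<close>
  let ?A = "\<lambda>k x. if k = l' then if x = i then 1 else 0 else Ws ! k $$ (x, r)"
  have len: "length Ws = length Is" using F by (simp add: factor_list_def)
  have W: "Ws ! k \<in> carrier_mat (Is ! k) R" if "k < length Is" for k
    using F that by (simp add: factor_list_def)
  have B: "?B ! k \<in> carrier_mat (Is ! k) R" if "k < length Is" for k
    using W[OF that] V that len by (cases "k = l") auto
  have D: "D l' $$ (p, r * Is ! l' + i) = - (\<Prod>k<length Is. ?A k (multi_indices Is ! p ! k))"
    if "p < ?N" for p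
  proof -
    have "(\<Prod>k\<in>{..<length Is} - {l'}. ?A k (multi_indices Is ! p ! k))
        = (\<Prod>k\<in>{..<length Is} - {l'}. Ws ! k $$ (multi_indices Is ! p ! k, r))"
      by (intro prod.cong) auto
    then show ?thesis
      using block_jacobian_residual_index[OF F l' that i r, of T] l'
      by (simp add: D_def prod.remove[of "{..<length Is}" l'])
  qed
  \<comment> \<open>At \<open>l'\<close> the unit vector picks out a single entry; at every other
    place an inner product of columns remains.\<close>
  have sum_ix: "(\<Sum>x<Is ! k. ?A k x * ?B ! k $$ (x, r'))
      = (if k = l' then ?B ! l' $$ (i, r') else col (?B ! k) r' \<bullet> col (Ws ! k) r)"
    if k: "k < length Is" and r': "r' < R" for k r'
  proof (cases "k = l'")
    case True
    have "(\<Sum>x<Is ! k. ?A k x * ?B ! k $$ (x, r')) = (\<Sum>x<Is ! k. if x = i then ?B ! k $$ (i, r') else 0)"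
      using True by (intro sum.cong) auto
    with True i show ?thesis by simp
  next
    case False
    have "col (?B ! k) r' \<bullet> col (Ws ! k) r = (\<Sum>x<Is ! k. ?B ! k $$ (x, r') * Ws ! k $$ (x, r))"
      using W[OF k] B[OF k] r r' by (simp add: scalar_prod_def lessThan_atLeast0)
    with False show ?thesis by (simp add: mult.commute)
  qed
  have "((transpose_mat (D l') * D l) *\<^sub>v vectorize V) $ (r * Is ! l' + i)
      = (\<Sum>p<?N. D l' $$ (p, r * Is ! l' + i) * (\<Sum>k<R * Is ! l. D l $$ (p, k) * vectorize V $ k))"
    unfolding D_def using carrier_matD[OF V]
    by (intro transpose_mult_mult_vec_index[OF block_jacobian_residual_carrier[OF F l']
          block_jacobian_residual_carrier[OF F l] _ mult_add_less[OF i r]] carrier_vecI)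
      (simp add: dim_vectorize)
  \<comment> \<open>The two minus signs cancel, and the two products merge index by index.\<close>
  also have "\<dots> = (\<Sum>p<?N. \<Sum>r'<R. \<Prod>k<length Is.
      ?A k (multi_indices Is ! p ! k) * ?B ! k $$ (multi_indices Is ! p ! k, r'))"
  proof (intro sum.cong refl)
    fix p assume "p \<in> {..<?N}"
    then have p: "p < ?N" by simp
    have "(\<Sum>k<R * Is ! l. D l $$ (p, k) * vectorize V $ k)
        = - (\<Sum>r'<R. \<Prod>k<length Is. ?B ! k $$ (multi_indices Is ! p ! k, r'))"
      unfolding D_def by (rule block_jacobian_residual_mult_vectorize[OF F l p V])
    then show "D l' $$ (p, r * Is ! l' + i) * (\<Sum>k<R * Is ! l. D l $$ (p, k) * vectorize V $ k)
        = (\<Sum>r'<R. \<Prod>k<length Is. ?A k (multi_indices Is ! p ! k) * ?B ! k $$ (multi_indices Is ! p ! k, r'))"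
      by (simp only: D[OF p] minus_mult_minus prod.distrib sum_distrib_left)
  qed
  \<comment> \<open>After exchanging the sums, the sum over multi-indices factors for each fixed
    \<open>r'\<close>.\<close>
  also have "\<dots> = (\<Sum>r'<R. \<Prod>k<length Is. \<Sum>x<Is ! k. ?A k x * ?B ! k $$ (x, r'))"
  proof -
    have "(\<Sum>p<?N. \<Prod>k<length Is. ?A k (multi_indices Is ! p ! k) * ?B ! k $$ (multi_indices Is ! p ! k, r'))
        = (\<Prod>k<length Is. \<Sum>x<Is ! k. ?A k x * ?B ! k $$ (x, r'))" for r'
      using sum_multi_indices_nth[of "\<lambda>idx. \<Prod>k<length Is. ?A k (idx ! k) * ?B ! k $$ (idx ! k, r')" Is]
        sum_list_multi_indices_prod[of "\<lambda>k x. ?A k x * ?B ! k $$ (x, r')" Is]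
      by (rule trans)
    then show ?thesis by (subst sum.swap) simp
  qed
  also have "\<dots> = (\<Sum>r'<R. ?B ! l' $$ (i, r')
        * (\<Prod>k\<in>{..<length Is} - {l'}. col (?B ! k) r' \<bullet> col (Ws ! k) r))"
    using l' by (intro sum.cong refl) (simp add: sum_ix prod.remove[of _ l'])
  finally show ?thesis .
qed

section \<open>Splitting the full Gramian into blocks\<close>

lemma stack_offset_less:
  assumes "l < length xs" "j < dim_vec (xs ! l)"
  shows "(\<Sum>x\<leftarrow>take l xs. dim_vec x) + j < dim_vec (stack xs)"
proof -
  have "dim_vec (stack xs) = (\<Sum>x\<leftarrow>take l xs @ xs ! l # drop (Suc l) xs. dim_vec x)"
    using assms by (simp add: dim_stack flip: id_take_nth_drop)
  then show ?thesis using assms by simp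
qed

text \<open>Moving the coordinate at offset \<open>j\<close> of block \<open>l\<close> changes only
  that block, so both entries are derivatives of the same function of \<open>s\<close>.\<close>

lemma jacobian_stack_index:
  assumes "l < length xs" "j < dim_vec (xs ! l)" "p < dim_vec (f (stack xs))"
  shows "jacobian f (stack xs) $$ (p, (\<Sum>x\<leftarrow>take l xs. dim_vec x) + j) = block_jacobian f xs l $$ (p, j)"
  using assms stack_offset_less[OF assms(1,2)]
  by (simp add: jacobian_def block_jacobian_def stack_add_unit_vec)

text \<open>The columns of the full Jacobian fall into blocks. Splitting the sum over columns
  accordingly and exchanging it with the sum over rows leaves one block Gramian per
  \<open>l\<close>.\<close>

lemma gramian_jacobian_stack_index:
  fixes f :: "real vec \<Rightarrow> real vec" and xs ys :: "real vec list"
  assumes len: "length ys = length xs" and dims: "\<And>l. l < length xs \<Longrightarrow> dim_vec (ys ! l) = dim_vec (xs ! l)"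
    and l': "l' < length xs" and j: "j < dim_vec (xs ! l')"
  defines "J \<equiv> jacobian f (stack xs)" and "D \<equiv> block_jacobian f xs"
  shows "((transpose_mat J * J) *\<^sub>v stack ys) $ ((\<Sum>x\<leftarrow>take l' xs. dim_vec x) + j)
    = (\<Sum>l<length xs. ((transpose_mat (D l') * D l) *\<^sub>v ys ! l) $ j)"
proof -
  let ?N = "dim_vec (f (stack xs))" and ?o = "\<lambda>l. \<Sum>x\<leftarrow>take l xs. dim_vec x"
  have map_dims: "map dim_vec ys = map dim_vec xs"
    using len dims by (intro nth_equalityI) auto
  then have dim: "dim_vec (stack ys) = dim_vec (stack xs)" by (simp add: dim_stack)
  have off: "(\<Sum>x\<leftarrow>take l ys. dim_vec x) = ?o l" for l
    using map_dims by (metis take_map)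
  have J: "J \<in> carrier_mat ?N (dim_vec (stack xs))" by (simp add: J_def jacobian_def)
  have D: "D l \<in> carrier_mat ?N (dim_vec (xs ! l))" for l
    by (simp add: D_def block_jacobian_def jacobian_def)
  have JD: "J $$ (p, ?o l + k) = D l $$ (p, k)"
    if "p < ?N" "l < length xs" "k < dim_vec (xs ! l)" for p l k
    using that unfolding J_def D_def by (intro jacobian_stack_index)
  have ys: "stack ys $ (?o l + k) = ys ! l $ k" if "l < length xs" "k < dim_vec (xs ! l)" for l k
    using that len dims off[of l] stack_index[of l ys k] by simp
  have "((transpose_mat J * J) *\<^sub>v stack ys) $ (?o l' + j)
      = (\<Sum>p<?N. J $$ (p, ?o l' + j) * (\<Sum>k<dim_vec (stack xs). J $$ (p, k) * stack ys $ k))"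
    using dim stack_offset_less[OF l' j]
    by (intro transpose_mult_mult_vec_index[OF J J] carrier_vecI)
  also have "\<dots> = (\<Sum>p<?N. D l' $$ (p, j) * (\<Sum>l<length xs. \<Sum>k<dim_vec (xs ! l). D l $$ (p, k) * ys ! l $ k))"
    unfolding sum_stack_index using l' j by (intro sum.cong refl arg_cong2[where f = "(*)"]) (simp_all add: JD ys)
  also have "\<dots> = (\<Sum>l<length xs. \<Sum>p<?N. D l' $$ (p, j) * (\<Sum>k<dim_vec (xs ! l). D l $$ (p, k) * ys ! l $ k))"
    by (subst sum.swap) (simp add: sum_distrib_left)
  also have "\<dots> = (\<Sum>l<length xs. ((transpose_mat (D l') * D l) *\<^sub>v ys ! l) $ j)"
    using transpose_mult_mult_vec_index[OF D D carrier_vecI j] dims by (intro sum.cong) auto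
  finally show ?thesis .
qed

section \<open>The matrix identities\<close>

text \<open>Quotient and remainder by the number of rows show that every position of the vector is
  that of some matrix entry.\<close>

lemma eq_vectorizeI:
  assumes "dim_vec x = dim_col X * dim_row X"
    and "\<And>i r. i < dim_row X \<Longrightarrow> r < dim_col X \<Longrightarrow> x $ (r * dim_row X + i) = X $$ (i, r)"
  shows "x = vectorize X"
proof (rule eq_vecI)
  fix k assume "k < dim_vec (vectorize X)"
  then have k: "k < dim_col X * dim_row X" by (simp add: dim_vectorize)
  \<comment> \<open>The existence of a position forces a row, so the remainder is a valid row
    index.\<close>
  then have "0 < dim_row X" by (cases "dim_row X") auto
  then have m: "k mod dim_row X < dim_row X" "k div dim_row X < dim_col X"
    using k by (auto simp: less_mult_imp_div_less)
  have "x $ (k div dim_row X * dim_row X + k mod dim_row X)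
      = vectorize X $ (k div dim_row X * dim_row X + k mod dim_row X)"
    using assms(2)[OF m] vectorize_index[OF m] by simp
  then show "x $ k = vectorize X $ k" by simp
qed (use assms(1) in \<open>simp add: dim_vectorize\<close>)

theorem theorem3p5p10:
  fixes Is :: "nat list" and R :: nat and T :: "nat list \<Rightarrow> real"
    and Ws Vs :: "real mat list" and w v :: "real vec"
  defines "L \<equiv> length Is"
    and "f \<equiv> residual Is R T"
  defines "dfdW \<equiv> block_jacobian f (map vectorize Ws)"
  assumes "L > 0" and "R > 0" and "\<forall>l<L. Is ! l > 0"
    and "factor_list Is R Ws" and "w = stack (map vectorize Ws)"
    and "v \<in> carrier_vec (R * sum_list Is)"
    and "factor_list Is R Vs" and "v = stack (map vectorize Vs)"
  shows "(transpose_mat (jacobian f w) * jacobian f w) *\<^sub>v v =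
           stack (map (\<lambda>l'. finsum_vec TYPE(real) (R * Is ! l')
             (\<lambda>l. (transpose_mat (dfdW l') * dfdW l) *\<^sub>v vectorize (Vs ! l)) {..<L}) [0..<L])
       \<and> (\<forall>l'<L. \<forall>l''<L. l' \<noteq> l'' \<longrightarrow>
           (transpose_mat (dfdW l') * dfdW l'') *\<^sub>v vectorize (Vs ! l'') =
             vectorize (Ws ! l' * hadamard (Pi_omit Ws R {l', l''})
                                    (transpose_mat (Vs ! l'') * Ws ! l'')))
       \<and> (\<forall>l'<L. (transpose_mat (dfdW l') * dfdW l') *\<^sub>v vectorize (Vs ! l') =
             vectorize (Vs ! l' * Pi_omit Ws R {l'}))"
proof (intro conjI allI impI)
  have len: "length Ws = L" "length Vs = L" and W: "\<And>l. l < L \<Longrightarrow> Ws ! l \<in> carrier_mat (Is ! l) R"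
    and V: "\<And>l. l < L \<Longrightarrow> Vs ! l \<in> carrier_mat (Is ! l) R"
    using assms by (auto simp: factor_list_def L_def)
  note F = \<open>factor_list Is R Ws\<close> and FV = \<open>factor_list Is R Vs\<close>
  have D: "dfdW l \<in> carrier_mat (length (multi_indices Is)) (R * Is ! l)" if "l < L" for l
    using block_jacobian_residual_carrier[OF F] that by (simp add: dfdW_def f_def L_def)
  have gram: "((transpose_mat (dfdW l') * dfdW l) *\<^sub>v vectorize (Vs ! l)) $ (r * Is ! l' + i)
    = (\<Sum>r'<R. Ws[l := Vs ! l] ! l' $$ (i, r')
        * (\<Prod>k\<in>{..<L} - {l'}. col (Ws[l := Vs ! l] ! k) r' \<bullet> col (Ws ! k) r))"
    if "l' < L" "l < L" "i < Is ! l'" "r < R" for l l' i r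
    using block_gramian_index[OF F _ _ V, of l' l i r T] that by (simp add: dfdW_def f_def L_def)
  {
    let ?xs = "map vectorize Ws" and ?ys = "map vectorize Vs"
    let ?G = "\<lambda>l' l. (transpose_mat (dfdW l') * dfdW l) *\<^sub>v vectorize (Vs ! l)"
    let ?zs = "map (\<lambda>l'. finsum_vec TYPE(real) (R * Is ! l') (?G l') {..<L}) [0..<L]"
    \<comment> \<open>\<open>finsum_vec\<close> is evaluated entrywise only for summands in the
      carrier.\<close>
    have G: "?G l' \<in> {..<L} \<rightarrow> carrier_vec (R * Is ! l')" if "l' < L" for l'
      using D[OF that] by (auto intro!: carrier_vecI)
    define zs where "zs = ?zs"
    \<comment> \<open>Both facts carry the premise \<open>l < L\<close>; where no such index is at
      hand, \<open>L > 0\<close> supplies one for \<open>lz\<close>.\<close>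
    have lz: "length zs = L" and z: "zs ! l = finsum_vec TYPE(real) (R * Is ! l) (?G l) {..<L}" if "l < L" for l
      using that by (auto simp: zs_def)
    have dz: "dim_vec (zs ! l) = R * Is ! l" if "l < L" for l
      using carrier_vecD[OF finsum_vec_closed[OF G[OF that]]] z[OF that] by simp
    have dx: "dim_vec (?xs ! l) = R * Is ! l" "dim_vec (?ys ! l) = R * Is ! l" if "l < L" for l
      using W[OF that] V[OF that] that len by (auto simp: dim_vectorize)
    have map_dims: "map dim_vec zs = map dim_vec ?xs"
    proof (rule nth_equalityI)
      fix l assume "l < length (map dim_vec zs)"
      then have l: "l < L" using lz \<open>L > 0\<close> by simp
      then have "map dim_vec zs ! l = dim_vec (zs ! l)" "map dim_vec ?xs ! l = dim_vec (?xs ! l)"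
        using lz len by (simp_all del: map_map)
      then show "map dim_vec zs ! l = map dim_vec ?xs ! l"
        using dz[OF l] dx(1)[OF l] by simp
    qed (use lz len \<open>L > 0\<close> in simp)
    have off: "(\<Sum>x\<leftarrow>take l zs. dim_vec x) = (\<Sum>x\<leftarrow>take l ?xs. dim_vec x)" for l
      using map_dims by (metis take_map)
    have dim: "dim_vec (stack zs) = dim_vec (stack ?xs)"
      unfolding dim_stack map_dims ..
    have "(transpose_mat (jacobian f w) * jacobian f w) *\<^sub>v v = stack zs"
    proof (rule eq_vecI)
      fix k assume "k < dim_vec (stack zs)"
      then obtain l j where l: "l < length zs" and j: "j < dim_vec (zs ! l)"
        and k: "k = (\<Sum>x\<leftarrow>take l zs. dim_vec x) + j"
        by (rule stack_index_cases)
      have l': "l < L" using l lz \<open>L > 0\<close> by simp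
      have j': "j < R * Is ! l" using j dz[OF l'] by simp
      have "((transpose_mat (jacobian f w) * jacobian f w) *\<^sub>v v) $ k = (\<Sum>m<length ?xs.
          ((transpose_mat (dfdW l) * dfdW m) *\<^sub>v ?ys ! m) $ j)"
        unfolding k off \<open>w = _\<close> \<open>v = _\<close> dfdW_def
        using l' j' dx len by (intro gramian_jacobian_stack_index) simp_all
      also have "\<dots> = (\<Sum>m<L. ?G l m $ j)"
        using len by simp
      also have "\<dots> = zs ! l $ j"
        using index_finsum_vec[OF _ j' G[OF l']] z[OF l'] by simp
      also have "\<dots> = stack zs $ k"
        unfolding k by (rule stack_index[OF l j, symmetric])
      finally show "((transpose_mat (jacobian f w) * jacobian f w) *\<^sub>v v) $ k = stack zs $ k" .
    next
      show "dim_vec ((transpose_mat (jacobian f w) * jacobian f w) *\<^sub>v v) = dim_vec (stack zs)"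
        using dim \<open>w = _\<close> by (simp add: jacobian_def)
    qed
    then show "(transpose_mat (jacobian f w) * jacobian f w) *\<^sub>v v = stack ?zs"
      unfolding zs_def .
  }
  {
    fix l' l'' assume l: "l' < L" "l'' < L" "l' \<noteq> l''"
    let ?H = "hadamard (Pi_omit Ws R {l', l''}) (transpose_mat (Vs ! l'') * Ws ! l'')"
    note Wl = W[OF l(1)] W[OF l(2)] V[OF l(2)]
    have prod: "(\<Prod>k\<in>{..<L} - {l'}. col (Ws[l'' := Vs ! l''] ! k) r' \<bullet> col (Ws ! k) r) = ?H $$ (r', r)"
      if "r < R" "r' < R" for r r'
    proof -
      \<comment> \<open>The place \<open>l''\<close> holds \<open>Vs ! l''\<close>, so its factor is
        entry \<open>(r', r)\<close> of the transpose of \<open>Vs ! l''\<close> times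
        \<open>Ws ! l''\<close>. The remaining places give the entry of
        \<open>Pi_omit\<close>.\<close>
      have "{..<L} - {l'} - {l''} = {..<L} - {l', l''}" by auto
      then show ?thesis
        using l Wl len that
        by (simp add: prod.remove[of "{..<L} - {l'}" l''] hadamard_def Pi_omit_def omega_def)
    qed
    show "(transpose_mat (dfdW l') * dfdW l'') *\<^sub>v vectorize (Vs ! l'') = vectorize (Ws ! l' * ?H)"
    proof (rule eq_vectorizeI)
      fix i r assume "i < dim_row (Ws ! l' * ?H)" "r < dim_col (Ws ! l' * ?H)"
      then have ir: "i < Is ! l'" "r < R" using Wl by (auto simp: hadamard_def Pi_omit_def)
      moreover have "dim_row ?H = R" "dim_col ?H = R" by (auto simp: hadamard_def Pi_omit_def)
      ultimately show "((transpose_mat (dfdW l') * dfdW l'') *\<^sub>v vectorize (Vs ! l'')) $ (r * dim_row (Ws ! l' * ?H) + i)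
          = (Ws ! l' * ?H) $$ (i, r)"
        using gram[OF l(1,2) ir] l Wl by (simp add: prod mult_index_sum del: index_mult_mat(1))
    qed (use Wl D[OF l(1)] in \<open>auto simp: hadamard_def Pi_omit_def\<close>)
  }
  {
    fix l' assume l: "l' < L"
    let ?P = "Pi_omit Ws R {l'}"
    note Vl = V[OF l]
    show "(transpose_mat (dfdW l') * dfdW l') *\<^sub>v vectorize (Vs ! l') = vectorize (Vs ! l' * ?P)"
    proof (rule eq_vectorizeI)
      fix i r assume "i < dim_row (Vs ! l' * ?P)" "r < dim_col (Vs ! l' * ?P)"
      then have ir: "i < Is ! l'" "r < R" using Vl by (auto simp: Pi_omit_def)
      moreover have "dim_row ?P = R" "dim_col ?P = R" by (auto simp: Pi_omit_def)
      \<comment> \<open>Here the replaced factor stands at \<open>l'\<close> itself, outside the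
        product, so every inner product left is an \<open>omega\<close> of the original
        factors.\<close>
      ultimately show "((transpose_mat (dfdW l') * dfdW l') *\<^sub>v vectorize (Vs ! l')) $ (r * dim_row (Vs ! l' * ?P) + i)
          = (Vs ! l' * ?P) $$ (i, r)"
        using gram[OF l l ir] l len Vl by (simp add: Pi_omit_def omega_def mult_index_sum del: index_mult_mat(1))
    qed (use Vl D[OF l] in \<open>auto simp: Pi_omit_def\<close>)
  }
qed

end
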